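(* For a positive integer $h$, let $\Phi_h(z)=\sum_{n\ge0}z^{2^{nh}/(2^h-1)}$, and let $\alpha$ be a further positive integer. Let $f(z)$ be the unique formal power series solution of $$zf^{2^h}(z)-f(z)+1=0.$$ Then $f(z)$, reduced modulo $2^{2^{\alpha h}}$, can be expressed as a polynomial in $\Phi_h(z)$ of degree at most $2^{(\alpha+1)h}-1$ with coefficients that are Laurent polynomials in $z^{1/(2^h-1)}$ over the integers.
   Context: Series are regarded as formal Laurent series in $z^{1/(2^h-1)}$ with integer coefficients; "reduced modulo $M$, can be expressed as" means that the coefficients of equal powers of $z^{1/(2^h-1)}$ of the two series agree modulo $M$. $f^{2^h}(z)$ denotes $(f(z))^{2^h}$. *)

theory Defs
  imports
    "HOL-Computational_Algebra.Computational_Algebra"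
    "HOL-Number_Theory.Cong"
begin

text \<open>
  Throughout, a Laurent series in \<open>z^(1/(2^h-1))\<close> is represented by an \<^typ>\<open>int fls\<close> whose formal
  variable \<^const>\<open>fls_X\<close> stands for \<open>w = z^(1/(2^h-1))\<close>.  A series \<open>f\<close> in \<open>z\<close> itself becomes the
  series \<open>f(w^(2^h-1))\<close>, i.e. \<open>fls_compose_power (fps_to_fls f) (2^h - 1)\<close>.
\<close>

text \<open>
  \<open>z^(2^(n*h)/(2^h-1)) = w^(2^(n*h))\<close>.  For \<open>h > 0\<close> the exponents are distinct, so every coefficient
  of the sum is 0 or 1; see \<open>Phi_sums\<close> below.
\<close>
definition Phi :: "nat \<Rightarrow> int fps" where
  "Phi h = Abs_fps (\<lambda>m. if \<exists>n. m = 2 ^ (n * h) then 1 else 0)"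

definition laurent_polynomial :: "'a::zero fls \<Rightarrow> bool" where
  "laurent_polynomial g \<longleftrightarrow> finite {n. fls_nth g n \<noteq> 0}"

definition fls_cong :: "int fls \<Rightarrow> int fls \<Rightarrow> int \<Rightarrow> bool" where
  "fls_cong a b M \<longleftrightarrow> (\<forall>n. [fls_nth a n = fls_nth b n] (mod M))"

lemma Phi_sums:
  assumes "h > 0"
  shows "(\<lambda>n. fps_X ^ (2 ^ (n * h))) sums Phi h"
  unfolding sums_def
proof (rule tendsto_fpsI)
  fix i :: nat
  have inj: "n = n'" if "(2::nat) ^ (n * h) = 2 ^ (n' * h)" for n n'
    using that assms by simp
  have "fps_nth (\<Sum>n<M. fps_X ^ (2 ^ (n * h))) i = fps_nth (Phi h) i" if "M \<ge> i" for M
  proof (cases "\<exists>n. i = 2 ^ (n * h)")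
    case True
    then obtain n where n: "i = 2 ^ (n * h)" by blast
    have "n \<le> n * h" using assms by simp
    also have "n * h < 2 ^ (n * h)" by (rule less_exp)
    finally have "n < M" using n \<open>M \<ge> i\<close> by linarith
    have "fps_nth (\<Sum>k<M. fps_X ^ (2 ^ (k * h)) :: int fps) i = (\<Sum>k<M. if k = n then 1 else 0)"
      unfolding fps_sum_nth
    proof (rule sum.cong)
      show "fps_nth (fps_X ^ (2 ^ (k * h)) :: int fps) i = (if k = n then 1 else 0)" for k
        unfolding fps_X_power_nth n using inj[of n k] by auto
    qed simp
    also have "\<dots> = 1" using \<open>n < M\<close> by simp
    also have "\<dots> = fps_nth (Phi h) i" unfolding Phi_def fps_nth_Abs_fps using True by simp
    finally show ?thesis .
  next
    case False
    then have "fps_nth (fps_X ^ (2 ^ (k * h)) :: int fps) i = 0" for k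
      unfolding fps_X_power_nth by auto
    then show ?thesis using False by (simp add: Phi_def fps_sum_nth)
  qed
  then show "\<forall>\<^sub>F M in sequentially.
      fps_nth (\<Sum>n<M. fps_X ^ (2 ^ (n * h))) i = fps_nth (Phi h) i"
    by (rule eventually_sequentiallyI)
qed

lemma functional_equation_ex1:
  "\<exists>!f :: int fps. fps_X * f ^ (2 ^ h) - f + 1 = 0"
proof -
  let ?m = "(2::nat) ^ h"
  have step: "fps_X ^ Suc k dvd fps_X * a ^ ?m - fps_X * b ^ ?m"
    if "fps_X ^ k dvd a - b" for a b :: "int fps" and k
  proof -
    have "a - b dvd a ^ ?m - b ^ ?m"
      by (simp add: power_diff_sumr2)
    with that have "fps_X ^ k dvd a ^ ?m - b ^ ?m" by (rule dvd_trans)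
    then show ?thesis by (simp add: right_diff_distrib[symmetric])
  qed
  have nth: "fps_nth a i = fps_nth b i" if dvd: "fps_X ^ k dvd a - b" and "i < k"
    for a b :: "int fps" and k i
  proof -
    obtain c where "a - b = fps_X ^ k * c" using dvd unfolding dvd_def by blast
    then have "fps_nth (a - b) i = 0" using \<open>i < k\<close> by (simp add: fps_X_power_mult_nth)
    then show ?thesis by simp
  qed
  have nth': "fps_X ^ k dvd a - b" if "\<And>i. i < k \<Longrightarrow> fps_nth a i = fps_nth b i"
    for a b :: "int fps" and k
  proof -
    have "a - b = fps_X ^ k * fps_shift k (a - b)"
      using that by (intro fps_ext) (auto simp: fps_X_power_mult_nth)
    then show ?thesis by (rule dvdI)
  qed
  define F where "F n = ((\<lambda>g :: int fps. 1 + fps_X * g ^ ?m) ^^ n) 1" for n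
  have F_Suc: "F (Suc n) = 1 + fps_X * F n ^ ?m" for n by (simp add: F_def)
  have F_dvd: "fps_X ^ Suc n dvd F (Suc n) - F n" for n
  proof (induction n)
    case 0 then show ?case by (simp add: F_def)
  next
    case (Suc n)
    from step[OF Suc] show ?case by (simp only: F_Suc add_diff_cancel_left)
  qed
  have F_stable: "fps_nth (F (k + d)) k = fps_nth (F k) k" for k d
  proof (induction d)
    case (Suc d)
    have "fps_nth (F (Suc (k + d))) k = fps_nth (F (k + d)) k" by (rule nth[OF F_dvd]) simp
    with Suc show ?case by simp
  qed simp
  define f where "f = Abs_fps (\<lambda>n. fps_nth (F n) n)"
  have f_F: "fps_X ^ Suc n dvd f - F n" for n
  proof (rule nth')
    fix i assume "i < Suc n"
    then show "fps_nth f i = fps_nth (F n) i" using F_stable[of i "n - i"] by (simp add: f_def)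
  qed
  have "1 + fps_X * f ^ ?m = f"
  proof (rule fps_ext)
    fix n
    have "fps_nth (fps_X * f ^ ?m) n = fps_nth (fps_X * F n ^ ?m) n"
      by (rule nth[OF step[OF f_F]]) simp
    then have "fps_nth (1 + fps_X * f ^ ?m) n = fps_nth (F (Suc n)) n"
      by (simp only: F_Suc fps_add_nth)
    also have "\<dots> = fps_nth f n" using F_stable[of n 1] by (simp add: f_def)
    finally show "fps_nth (1 + fps_X * f ^ ?m) n = fps_nth f n" .
  qed
  then have ex: "fps_X * f ^ ?m - f + 1 = 0" by (simp add: algebra_simps)
  moreover have "g = f" if g: "fps_X * g ^ ?m - g + 1 = 0" for g :: "int fps"
  proof (rule fps_ext)
    have "(g - f) - (fps_X * g ^ ?m - fps_X * f ^ ?m)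
        = (fps_X * f ^ ?m - f + 1) - (fps_X * g ^ ?m - g + 1)"
      by (simp only: algebra_simps)
    then have *: "g - f = fps_X * g ^ ?m - fps_X * f ^ ?m" unfolding g ex by simp
    have "fps_X ^ k dvd g - f" for k
    proof (induction k)
      case (Suc k)
      from step[OF this] show ?case by (simp only: *)
    qed simp
    then show "fps_nth g n = fps_nth f n" for n using nth[of "Suc n"] by blast
  qed
  ultimately show ?thesis by blast
qed

end

theory Submission
  imports Defs
begin

text \<open>
  Put \<open>q = 2^h\<close>, \<open>z = w^(q-1)\<close> and \<open>G(w) = w f(w^(q-1))\<close>.  The functional equation becomes
  \<open>G = w + G^q\<close>, and iterating it modulo 2 gives \<open>G \<equiv> w + w^q + \<dots> + w^(q^(n-1)) + G^(q^n)\<close>, so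
  \<open>G \<equiv> \<Phi>\<close> modulo 2.  Since \<open>a \<equiv> b\<close> modulo \<open>2^k\<close> implies \<open>a^q \<equiv> b^q\<close> modulo \<open>2^(k+1)\<close>, iterating
  \<open>x \<mapsto> x^q + w\<close> from \<open>\<Phi>\<close> approximates \<open>G\<close> modulo any power of 2 by polynomials in \<open>\<Phi>\<close>.
  Finally \<open>\<Phi>^q - \<Phi> + w \<equiv> 0\<close> modulo 2, hence \<open>(\<Phi>^q - \<Phi> + w)^(q^\<alpha>) \<equiv> 0\<close> modulo \<open>2^(q^\<alpha>)\<close>, and
  division with remainder by this monic polynomial in \<open>\<Phi>\<close> of degree \<open>q^(\<alpha>+1)\<close> bounds the degree.
\<close>

text \<open>Iterated Frobenius modulo 2: each squaring contributes only the even cross term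
  \<open>2 * (?x * ?y)\<close>.\<close>

lemma two_dvd_power_two_power_add:
  fixes a b :: "'a :: comm_ring_1"
  shows "2 dvd (a + b) ^ (2 ^ k) - (a ^ (2 ^ k) + b ^ (2 ^ k))"
proof (induction k)
  case 0
  then show ?case by simp
next
  case (Suc k)
  let ?s = "(a + b) ^ (2 ^ k)" and ?x = "a ^ (2 ^ k)" and ?y = "b ^ (2 ^ k)"
  have sq: "c ^ (2 ^ Suc k) = (c ^ (2 ^ k)) ^ 2" for c :: 'a
    by (simp flip: power_mult add: mult.commute)
  have "?s ^ 2 - (?x ^ 2 + ?y ^ 2) = (?s - (?x + ?y)) * (?s + (?x + ?y)) + 2 * (?x * ?y)"
    by (simp add: algebra_simps power2_eq_square)
  also have "2 dvd \<dots>"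
    using Suc by (intro dvd_add dvd_mult2 dvd_triv_left)
  finally show ?case
    unfolding sq .
qed

text \<open>The extra factor 2 comes from \<open>a ^ j + b ^ j\<close>, which is
  \<open>a ^ j - b ^ j\<close> plus \<open>2 * b ^ j\<close>. Both summands are even because the
  exponent \<open>Suc k\<close> is positive.\<close>

lemma two_power_dvd_power_diff:
  fixes a b :: "'a :: comm_ring_1"
  assumes "2 ^ Suc k dvd a - b" and "even m"
  shows "2 ^ Suc (Suc k) dvd a ^ m - b ^ m"
proof -
  obtain j where m: "m = 2 * j" using \<open>even m\<close> by blast
  have "a - b dvd a ^ j - b ^ j"
    by (simp add: power_diff_sumr2)
  with assms(1) obtain c where c: "a ^ j - b ^ j = 2 ^ Suc k * c"
    by (meson dvd_trans dvdE)
  have "a ^ m - b ^ m = (a ^ j - b ^ j) * ((a ^ j - b ^ j) + 2 * b ^ j)"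
    unfolding m by (subst (1 2) mult.commute) (simp add: power_mult power2_eq_square algebra_simps)
  also have "\<dots> = 2 ^ Suc (Suc k) * (c * (2 ^ k * c + b ^ j))"
    unfolding c by (simp add: algebra_simps)
  finally show ?thesis by simp
qed

lemma numeral_dvd_fps:
  fixes f :: "int fps"
  assumes "\<And>n. numeral m dvd fps_nth f n"
  shows "numeral m dvd f"
proof
  show "f = numeral m * Abs_fps (\<lambda>n. fps_nth f n div numeral m)"
    using assms by (intro fps_ext) (simp add: numeral_fps_const)
qed

lemma Phi_nth_eq_sum:
  assumes "h > 0" and "m < 2 ^ (n * h)"
  shows "fps_nth (Phi h) m = fps_nth (\<Sum>k<n. fps_X ^ (2 ^ (k * h))) m"
proof (cases "\<exists>i. m = 2 ^ (i * h)")
  case True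
  then obtain i where i: "m = 2 ^ (i * h)" by blast
  with assms have "i < n" by simp
  have "fps_nth (\<Sum>k<n. fps_X ^ (2 ^ (k * h)) :: int fps) m = (\<Sum>k<n. if k = i then 1 else 0)"
    unfolding fps_sum_nth fps_X_power_nth using assms(1) by (intro sum.cong) (auto simp: i)
  with \<open>i < n\<close> True show ?thesis by (simp add: Phi_def)
next
  case False
  then show ?thesis by (simp add: Phi_def fps_sum_nth fps_X_power_nth)
qed

text \<open>Raising the equation for \<open>G\<close> to the power \<open>2 ^ (n * h)\<close> peels
  off one more term of \<open>Phi h\<close> modulo 2. By \<open>G0\<close> the remaining power of
  \<open>G\<close> has order at least \<open>2 ^ (n * h)\<close>, so it cannot reach low
  coefficients.\<close>

lemma artin_schreier_root_cong_Phi: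
  fixes G :: "int fps"
  assumes "h > 0" and G: "G = fps_X + G ^ (2 ^ h)" and G0: "fps_nth G 0 = 0"
  shows "2 dvd G - Phi h"
proof -
  have dvd: "2 dvd G - ((\<Sum>k<n. fps_X ^ (2 ^ (k * h))) + G ^ (2 ^ (n * h)))" for n
  proof (induction n)
    case (Suc n)
    have "G ^ (2 ^ (n * h)) = (fps_X + G ^ (2 ^ h)) ^ (2 ^ (n * h))"
      using G by metis
    moreover have "(G ^ (2 ^ h)) ^ (2 ^ (n * h)) = G ^ (2 ^ (Suc n * h))"
      by (simp flip: power_mult power_add)
    ultimately have "2 dvd G ^ (2 ^ (n * h)) - (fps_X ^ (2 ^ (n * h)) + G ^ (2 ^ (Suc n * h)))"
      using two_dvd_power_two_power_add[of fps_X "G ^ (2 ^ h)" "n * h"] by simp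
    from dvd_add[OF Suc this] show ?case by (simp add: algebra_simps)
  qed simp
  show ?thesis
  proof (rule numeral_dvd_fps)
    fix m
    \<comment> \<open>This allows \<open>n = m\<close> peeling steps for coefficient
      \<open>m\<close>.\<close>
    have m: "m < 2 ^ (m * h)"
      using \<open>h > 0\<close> by (intro le_less_trans[OF _ less_exp]) simp
    obtain c where c: "G - ((\<Sum>k<m. fps_X ^ (2 ^ (k * h))) + G ^ (2 ^ (m * h))) = 2 * c"
      using dvd[of m] by blast
    have "fps_nth (G ^ (2 ^ (m * h))) m = 0"
      using startsby_zero_power_prefix[OF G0] m by blast
    then have "fps_nth (G - Phi h) m
        = fps_nth (G - ((\<Sum>k<m. fps_X ^ (2 ^ (k * h))) + G ^ (2 ^ (m * h)))) m"
      using Phi_nth_eq_sum[OF \<open>h > 0\<close> m] by simp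
    also have "2 dvd \<dots>"
      unfolding c by (simp add: numeral_fps_const)
    finally show "2 dvd fps_nth (G - Phi h) m" .
  qed
qed

text \<open>The inner variable is \<open>w\<close>, the outer one is replaced by \<open>x\<close>.
  Coefficients stay genuine polynomials in \<open>w\<close>, so their finiteness is automatic and
  division takes place in a polynomial ring over a domain.\<close>

definition eval_fps2 :: "'a :: comm_ring_1 fps \<Rightarrow> 'a poly poly \<Rightarrow> 'a fps" where
  "eval_fps2 x p = poly (map_poly fps_of_poly p) x"

lemma eval_fps2_0 [simp]: "eval_fps2 x 0 = 0"
  by (simp add: eval_fps2_def)

lemma eval_fps2_pCons [simp]: "eval_fps2 x (pCons a p) = fps_of_poly a + x * eval_fps2 x p"
  by (simp add: eval_fps2_def map_poly_pCons)

lemma eval_fps2_1 [simp]: "eval_fps2 x 1 = 1"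
  by (subst one_pCons) simp

lemma eval_fps2_add [simp]: "eval_fps2 x (p + q) = eval_fps2 x p + eval_fps2 x q"
  by (induction p q rule: poly_induct2) (simp_all add: fps_of_poly_add algebra_simps)

lemma eval_fps2_smult [simp]: "eval_fps2 x (smult a p) = fps_of_poly a * eval_fps2 x p"
  by (induction p) (simp_all add: fps_of_poly_mult algebra_simps)

lemma eval_fps2_mult [simp]: "eval_fps2 x (p * q) = eval_fps2 x p * eval_fps2 x q"
  by (induction p) (simp_all add: algebra_simps)

lemma eval_fps2_power [simp]: "eval_fps2 x (p ^ n) = eval_fps2 x p ^ n"
  by (induction n) simp_all

text \<open>Starting from the outer variable itself, each passage from \<open>p\<close> to
  \<open>w + p ^ q\<close> gains one factor 2.\<close>

lemma fixed_point_cong_eval_fps2: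
  fixes x G :: "int fps"
  assumes "even q" and G: "G = fps_X + G ^ q" and x: "2 dvd G - x"
  shows "\<exists>p. 2 ^ Suc k dvd G - eval_fps2 x p"
proof (induction k)
  case 0
  from x show ?case by (intro exI[of _ "[:0, 1:]"]) simp
next
  case (Suc k)
  then obtain p where "2 ^ Suc k dvd G - eval_fps2 x p" by blast
  from two_power_dvd_power_diff[OF this \<open>even q\<close>]
  have "2 ^ Suc (Suc k) dvd (fps_X + G ^ q) - (fps_X + eval_fps2 x p ^ q)"
    by simp
  then show ?case
    by (intro exI[of _ "[:[:0, 1:]:] + p ^ q"]) (simp flip: G)
qed

text \<open>Pseudo-division scales \<open>f\<close> by a power of the leading coefficient, here 1,
  so no field is required.\<close>

lemma monic_division:
  fixes f g :: "'a :: idom poly"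
  assumes "lead_coeff g = 1"
  obtains q r where "f = g * q + r" and "r = 0 \<or> degree r < degree g"
proof -
  have "g \<noteq> 0" using assms by auto
  from pseudo_divmod[OF this, of f] show ?thesis
    using that assms by (metis power_one smult_1_left prod.exhaust)
qed

lemma artin_schreier_poly_degree_monic:
  fixes q :: nat and c :: "'a :: idom"
  assumes "q > 1"
  defines "P \<equiv> [:0, 1:] ^ q + [:c, - 1:]"
  shows "degree P = q" and "lead_coeff P = 1"
proof -
  have "degree [:c, - 1:] < degree ([:0, 1:] ^ q :: 'a poly)"
    using assms(1) by (simp add: degree_power_eq)
  moreover have "coeff ([:0, 1:] ^ q :: 'a poly) q = 1"
    using lead_coeff_power[of "[:0, 1:] :: 'a poly" q] by (simp add: degree_power_eq)
  ultimately show "degree P = q" "lead_coeff P = 1"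
    unfolding P_def by (simp_all add: degree_add_eq_left degree_power_eq coeff_eq_0)
qed

lemma laurent_polynomial_X_inv_times_fps_of_poly:
  "laurent_polynomial (fls_X_inv * fps_to_fls (fps_of_poly (a :: int poly)))"
proof -
  \<comment> \<open>The factor \<open>fls_X_inv\<close> shifts exponents down by one, hence the
    lower bound \<open>- 1\<close>.\<close>
  have "{n. fls_nth (fls_X_inv * fps_to_fls (fps_of_poly a)) n \<noteq> 0} \<subseteq> {- 1..int (degree a)}"
  proof
    fix n assume "n \<in> {n. fls_nth (fls_X_inv * fps_to_fls (fps_of_poly a)) n \<noteq> 0}"
    then have "n + 1 \<ge> 0" and "coeff a (nat (n + 1)) \<noteq> 0"
      by (auto simp: fls_X_inv_times_conv_shift split: if_splits)
    then show "n \<in> {- 1..int (degree a)}"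
      using le_degree[of a "nat (n + 1)"] by auto
  qed
  then show ?thesis
    unfolding laurent_polynomial_def by (rule finite_subset) simp
qed

lemma poly_X_inv_fps_of_poly:
  fixes x :: "'a :: comm_ring_1 fps"
  shows "poly (map_poly (\<lambda>a. fls_X_inv * fps_to_fls (fps_of_poly a)) p) (fps_to_fls x)
    = fls_X_inv * fps_to_fls (eval_fps2 x p)"
  by (induction p) (simp_all add: map_poly_pCons fls_times_fps_to_fls algebra_simps)

lemma fls_cong_if_dvd:
  assumes "(2 :: int fls) ^ N dvd a - b"
  shows "fls_cong a b (2 ^ N)"
proof -
  obtain c where c: "a - b = 2 ^ N * c" using assms by blast
  have "(2 :: int fls) ^ N = fls_const (2 ^ N)"
    by (metis fls_const_numeral fls_const_power)
  then have "fls_nth a n - fls_nth b n = 2 ^ N * fls_nth c n" for n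
    using arg_cong[OF c, of "\<lambda>f. fls_nth f n"] by simp
  then show ?thesis
    unfolding fls_cong_def cong_iff_dvd_diff by simp
qed

theorem theorem33:
  fixes h \<alpha> :: nat and f :: "int fps"
  assumes "h > 0" and "\<alpha> > 0"
    and "fps_X * f ^ (2 ^ h) - f + 1 = 0"
  shows "\<exists>p :: int fls poly.
           degree p \<le> 2 ^ ((\<alpha> + 1) * h) - 1 \<and>
           (\<forall>i. laurent_polynomial (coeff p i)) \<and>
           fls_cong (fls_compose_power (fps_to_fls f) (2 ^ h - 1))
                    (poly p (fps_to_fls (Phi h)))
                    (2 ^ (2 ^ (\<alpha> * h)))"
proof -
  define q where "q = (2 :: nat) ^ h"
  define N where "N = (2 :: nat) ^ (\<alpha> * h)"
  define x where "x = Phi h"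
  have q: "q > 1" "even q" using \<open>h > 0\<close> one_less_power[of "2 :: nat" h] by (simp_all add: q_def)
  have d: "q - 1 > 0" using q by simp
  have N: "N > 0" by (simp add: N_def)
  have qN: "q * N = 2 ^ ((\<alpha> + 1) * h)"
    by (simp add: q_def N_def flip: power_add)

  define F where "F = fps_compose f (fps_X ^ (q - 1))"
  define G where "G = fps_X * F"
  have X0: "fps_nth (fps_X ^ (q - 1) :: int fps) 0 = 0"
    using d by simp
  have "f = 1 + fps_X * f ^ q"
    using assms(3) by (simp add: q_def algebra_simps)
  then have "F = fps_compose (1 + fps_X * f ^ q) (fps_X ^ (q - 1))"
    by (simp only: F_def)
  also have "\<dots> = 1 + fps_X ^ (q - 1) * F ^ q"
    by (simp only: F_def fps_compose_power[OF X0] fps_compose_add_distrib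
        fps_compose_mult_distrib[OF X0] fps_compose_1 fps_X_fps_compose_startby0[OF X0])
  finally have "G = fps_X + (fps_X * fps_X ^ (q - 1)) * F ^ q"
    unfolding G_def by (metis distrib_left mult.assoc mult_1_right)
  also have "fps_X * fps_X ^ (q - 1) = (fps_X ^ q :: int fps)"
    using d by (simp flip: power_Suc)
  also have "fps_X + fps_X ^ q * F ^ q = fps_X + G ^ q"
    by (simp only: G_def power_mult_distrib)
  finally have G: "G = fps_X + G ^ q" .
  have Gx: "2 dvd G - x"
    unfolding x_def using \<open>h > 0\<close> G by (intro artin_schreier_root_cong_Phi) (simp_all add: q_def G_def)

  define P :: "int poly poly" where "P = [:0, 1:] ^ q + [:[:0, 1:], - 1:]"
  \<comment> \<open>\<open>P\<close> is \<open>T ^ q - T + w\<close> in the outer variable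
    \<open>T\<close>, and \<open>G\<close> is a root of it; subtracting its value at
    \<open>G\<close> leaves only differences divisible by \<open>G - x\<close>.\<close>
  have "eval_fps2 x P = (G - x) - (G ^ q - x ^ q)"
    by (subst (1) G) (simp add: P_def fps_of_poly_uminus)
  moreover have "G - x dvd G ^ q - x ^ q"
    by (simp add: power_diff_sumr2)
  then have "2 dvd G ^ q - x ^ q"
    using Gx dvd_trans by blast
  ultimately have "2 dvd eval_fps2 x P"
    using Gx by (simp only: dvd_diff)
  then have P_dvd: "2 ^ N dvd eval_fps2 x (P ^ N)"
    by (simp add: dvd_power_same)
  have P: "degree P = q" "lead_coeff P = 1"
    unfolding P_def by (rule artin_schreier_poly_degree_monic[OF q(1)])+
  then have "P \<noteq> 0" by auto
  then have P_degree: "degree (P ^ N) = q * N"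
    using P(1) degree_power_eq[of P N] by (simp add: mult.commute)
  have P_monic: "lead_coeff (P ^ N) = 1"
    using P(2) by (simp only: lead_coeff_power power_one)

  obtain s where s: "2 ^ N dvd G - eval_fps2 x s"
    using fixed_point_cong_eval_fps2[OF q(2) G Gx, of "N - 1"] N by auto
  \<comment> \<open>Modulo \<open>2 ^ N\<close> the multiple of \<open>P ^ N\<close> vanishes at
    \<open>x\<close>, so the remainder \<open>r\<close> approximates \<open>G\<close> as well as
    \<open>s\<close> does.\<close>
  obtain t r where tr: "s = P ^ N * t + r" "r = 0 \<or> degree r < q * N"
    using monic_division[OF P_monic] P_degree by metis
  have "G - eval_fps2 x r = (G - eval_fps2 x s) + eval_fps2 x (P ^ N) * eval_fps2 x t"
    by (simp add: tr(1))
  also have "2 ^ N dvd \<dots>"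
    using s P_dvd by (intro dvd_add dvd_mult2)
  finally obtain c where c: "G - eval_fps2 x r = 2 ^ N * c" by blast

  \<comment> \<open>Since \<open>G\<close> is \<open>w\<close> times \<open>F\<close>, dividing by
    \<open>w\<close> recovers \<open>F\<close>; this is the only source of a negative power of
    \<open>w\<close>.\<close>
  define p where "p = map_poly (\<lambda>a. fls_X_inv * fps_to_fls (fps_of_poly a)) r"
  have "degree p \<le> degree r"
    unfolding p_def by (rule map_poly_degree_leq)
  then have "degree p \<le> 2 ^ ((\<alpha> + 1) * h) - 1"
    using tr(2) unfolding qN by auto
  moreover have "\<forall>i. laurent_polynomial (coeff p i)"
    by (simp add: p_def coeff_map_poly laurent_polynomial_X_inv_times_fps_of_poly)
  moreover have "fls_cong (fls_compose_power (fps_to_fls f) (q - 1)) (poly p (fps_to_fls x)) (2 ^ N)"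
  proof (rule fls_cong_if_dvd)
    have "fls_compose_power (fps_to_fls f) (q - 1) = fps_to_fls F"
      using d by (simp add: fls_compose_power_fps_to_fls F_def)
    moreover have "fls_X_inv * fls_X = (1 :: int fls)"
      by (intro fls_eqI) (simp add: fls_X_inv_times_conv_shift)
    ultimately have "fls_compose_power (fps_to_fls f) (q - 1) = fls_X_inv * fps_to_fls G"
      by (simp add: G_def fls_times_fps_to_fls flip: mult.assoc)
    then have "fls_compose_power (fps_to_fls f) (q - 1) - poly p (fps_to_fls x)
        = fls_X_inv * fps_to_fls (G - eval_fps2 x r)"
      by (simp add: p_def poly_X_inv_fps_of_poly algebra_simps)
    also have "\<dots> = 2 ^ N * (fls_X_inv * fps_to_fls c)"
      unfolding c by (simp add: fls_times_fps_to_fls fps_to_fls_power)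
    finally show "2 ^ N dvd fls_compose_power (fps_to_fls f) (q - 1) - poly p (fps_to_fls x)"
      by simp
  qed
  ultimately show ?thesis
    unfolding q_def N_def x_def by blast
qed

end
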